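(* Let $\Omega$ be a set of nonzero $n$-tuples over $\{0,1\}$ such that $r(\Omega)=n$, and such that either $s(\beta)$ is even for all $\beta\in\Omega$ or $s(\beta)$ is odd for all $\beta\in\Omega$. Let $k=\min_{\beta\in\Omega}s(\beta)$ and $\Omega^{*}=\{\beta\in\Omega: s(\beta)=k\}$. If $\sum_{\beta\in\Omega^{*}}\beta\neq\mathbf{0}$ in $\mathbb{Z}_{2}^{n}$, then $NEPS(P_{3},\ldots,P_{3};\Omega)$ allows perfect state transfer (between some pair of distinct vertices) at time $\tau_{k}=\pi/(\sqrt{2})^{k}$.
   Context: $P_{3}$ is the path with vertices $1,2,3$ where $1$ and $3$ are adjacent to $2$. For a set $\Omega$ of nonzero $n$-tuples $\beta\in\{0,1\}^{n}$, $NEPS(P_{3},\ldots,P_{3};\Omega)$ ($n$ factors) has vertex set $\{1,2,3\}^{n}$, and $(x_{i})$, $(y_{i})$ are adjacent iff for some $\beta\in\Omega$, $x_{i}=y_{i}$ whenever $\beta_{i}=0$ and $x_{i}$ is adjacent to $y_{i}$ in $P_{3}$ whenever $\beta_{i}=1$. $r(\Omega)$ is the rank over $\mathbb{Z}_{2}$ of the matrix whose rows are the elements of $\Omega$. $s(\beta)$ is the number of nonzero entries of $\beta$. For a graph with adjacency matrix $A$, perfect state transfer from $u$ to $v$ at time $\tau$ means $|e_{u}^{T}\exp(-i\tau A)e_{v}|=1$. *)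

theory Defs
  imports "HOL-Analysis.Analysis" "HOL-Library.Z2" "HOL-Library.Numeral_Type"
begin

text \<open>A graph on a vertex type is given by its adjacency relation. The tuples over
  \<open>{0,1}\<close> are vectors in \<open>bit ^ 'n\<close>, with \<open>n = CARD('n)\<close>; \<open>bit\<close> is the
  field with two elements.\<close>

instance bit :: finite
proof
  have "(UNIV :: bit set) = {0, 1}"
    using bit_not_zero_iff by auto
  then show "finite (UNIV :: bit set)"
    by (metis finite.emptyI finite.insertI)
qed

text \<open>The vertices 1, 2, 3 are the three elements of the numeral type \<open>3\<close>, in which
  the numeral 3 denotes the same element as 0.\<close>

definition P3 :: "3 \<Rightarrow> 3 \<Rightarrow> bool" where
  "P3 x y \<longleftrightarrow> {x, y} = {1, 2} \<or> {x, y} = {2, 3}"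

definition NEPS :: "('n::finite \<Rightarrow> 'v \<Rightarrow> 'v \<Rightarrow> bool) \<Rightarrow> (bit ^ 'n) set \<Rightarrow> 'v ^ 'n \<Rightarrow> 'v ^ 'n \<Rightarrow> bool" where
  "NEPS G \<Omega> x y \<longleftrightarrow>
     (\<exists>\<beta>\<in>\<Omega>. \<forall>i. (\<beta> $ i = 0 \<longrightarrow> x $ i = y $ i) \<and> (\<beta> $ i = 1 \<longrightarrow> G i (x $ i) (y $ i)))"

definition weight :: "bit ^ 'n::finite \<Rightarrow> nat" where
  "weight \<beta> = card {i. \<beta> $ i \<noteq> 0}"

text \<open>The rank of the matrix whose rows are the elements of \<open>\<Omega>\<close>, over the
  two-element field. As in the library's \<open>rank\<close>, \<open>vec.dim\<close> of a set of vectors is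
  the dimension of its span.\<close>

definition rank_Z2 :: "(bit ^ 'n::finite) set \<Rightarrow> nat" where
  "rank_Z2 \<Omega> = vec.dim \<Omega>"

definition adjacency_matrix :: "('v::finite \<Rightarrow> 'v \<Rightarrow> bool) \<Rightarrow> complex ^ 'v ^ 'v" where
  "adjacency_matrix E = (\<chi> u v. if E u v then 1 else 0)"

text \<open>The type of square matrices carries the componentwise multiplication as \<open>*\<close>, so
  powers and the exponential series have to be built from the matrix product \<open>**\<close>.\<close>

definition matrix_power :: "complex ^ 'v ^ 'v \<Rightarrow> nat \<Rightarrow> complex ^ 'v ^ 'v::finite" where
  "matrix_power M m = (((**) M) ^^ m) (mat 1)"

definition matrix_exp :: "complex ^ 'v ^ 'v \<Rightarrow> complex ^ 'v ^ 'v::finite" where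
  "matrix_exp M = (\<Sum>m. matrix_power M m /\<^sub>R fact m)"

definition perfect_state_transfer :: "('v::finite \<Rightarrow> 'v \<Rightarrow> bool) \<Rightarrow> 'v \<Rightarrow> 'v \<Rightarrow> real \<Rightarrow> bool" where
  "perfect_state_transfer E u v \<tau> \<longleftrightarrow>
     cmod (matrix_exp (\<chi> a b. - \<i> * complex_of_real \<tau> * adjacency_matrix E $ a $ b) $ u $ v) = 1"

end

theory Submission
  imports Defs
begin

text \<open>The eigenvalues of \<open>P\<^sub>3\<close> are \<open>\<surd>2 l\<close> with \<open>l \<in> {-1,0,1}\<close>, and products of eigenvectors are
  eigenvectors of the NEPS, with eigenvalue \<open>\<Sum>\<beta>. \<Prod>i. (\<surd>2 l\<^sub>i)^\<beta>\<^sub>i\<close>. At time \<open>\<pi> / (\<surd>2)^k\<close> every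
  \<open>\<beta>\<close> with \<open>s(\<beta>) > k\<close> contributes a phase in \<open>2\<pi>\<int>\<close>, since \<open>s(\<beta>) - k\<close> is even, whereas
  \<open>\<beta> \<in> \<Omega>\<^sup>*\<close> contributes the sign \<open>-1\<close> exactly when no \<open>l\<^sub>i\<close> with \<open>\<beta>\<^sub>i = 1\<close> vanishes. Choose a coordinate
  \<open>j\<close> at which \<open>\<Sum>\<beta>\<in>\<Omega>\<^sup>*. \<beta>\<close> is nonzero, and let \<open>u\<close>, \<open>v\<close> have \<open>1\<close>, \<open>3\<close> at \<open>j\<close> and \<open>2\<close>
  elsewhere. Only eigenvectors with \<open>l\<^sub>i \<noteq> 0\<close> for \<open>i \<noteq> j\<close> occur in \<open>e\<^sub>v\<close>; passing from \<open>e\<^sub>v\<close> to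
  \<open>e\<^sub>u\<close> changes the sign of those with \<open>l\<^sub>j = 0\<close>, and so, up to a global sign, does the
  exponential.\<close>

section \<open>Matrix exponentials\<close>

text \<open>The sum of all entry moduli dominates every row sum, so the bound survives one more
  factor \<open>M\<close>.\<close>

lemma norm_matrix_power_entry_le:
  fixes M :: "complex ^ 'v ^ 'v::finite"
  shows "cmod (matrix_power M m $ a $ b) \<le> (\<Sum>a\<in>UNIV. \<Sum>b\<in>UNIV. cmod (M $ a $ b)) ^ m"
proof (induction m arbitrary: a b)
  case 0
  then show ?case by (simp add: matrix_power_def mat_def)
next
  case (Suc m)
  let ?K = "\<Sum>a\<in>UNIV. \<Sum>b\<in>UNIV. cmod (M $ a $ b)"
  have "matrix_power M (Suc m) $ a $ b = (\<Sum>c\<in>UNIV. M $ a $ c * matrix_power M m $ c $ b)"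
    by (simp add: matrix_power_def matrix_matrix_mult_def)
  also have "cmod \<dots> \<le> (\<Sum>c\<in>UNIV. cmod (M $ a $ c) * ?K ^ m)"
    by (rule sum_norm_le) (simp add: norm_mult mult_left_mono Suc)
  also have "\<dots> = (\<Sum>c\<in>UNIV. cmod (M $ a $ c)) * ?K ^ m"
    by (simp add: sum_distrib_right)
  also have "\<dots> \<le> ?K * ?K ^ m"
    by (intro mult_right_mono member_le_sum zero_le_power sum_nonneg) auto
  finally show ?case by simp
qed

text \<open>Convergence is what lets bounded linear maps be exchanged with the series in
  \<open>matrix_exp\<close>.\<close>

lemma summable_matrix_exp:
  fixes M :: "complex ^ 'v ^ 'v::finite"
  shows "summable (\<lambda>m. matrix_power M m /\<^sub>R fact m)"
proof (rule summable_comparison_test')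
  define K where "K = (\<Sum>a\<in>UNIV. \<Sum>b\<in>UNIV. cmod (M $ a $ b))"
  show "summable (\<lambda>m. real (CARD('v) * CARD('v)) * (K ^ m /\<^sub>R fact m))"
    by (intro summable_mult summable_exp_generic)
  fix m :: nat
  have "norm (matrix_power M m) \<le> (\<Sum>a\<in>UNIV. norm (matrix_power M m $ a))"
    unfolding norm_vec_def by (rule L2_set_le_sum) simp
  also have "\<dots> \<le> (\<Sum>a\<in>UNIV. \<Sum>b\<in>UNIV. cmod (matrix_power M m $ a $ b))"
    unfolding norm_vec_def by (intro sum_mono L2_set_le_sum) simp
  also have "\<dots> \<le> (\<Sum>a\<in>(UNIV::'v set). \<Sum>b\<in>(UNIV::'v set). K ^ m)"
    unfolding K_def by (intro sum_mono norm_matrix_power_entry_le)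
  finally have "norm (matrix_power M m) \<le> real (CARD('v) * CARD('v)) * K ^ m"
    by simp
  then show "norm (matrix_power M m /\<^sub>R fact m) \<le> real (CARD('v) * CARD('v)) * (K ^ m /\<^sub>R fact m)"
    by (simp add: field_simps)
qed

lemma matrix_power_eigenvector:
  assumes "M *v w = \<mu> *s w"
  shows "matrix_power M m *v w = \<mu> ^ m *s w"
proof (induction m)
  case 0
  then show ?case by (simp add: matrix_power_def)
next
  case (Suc m)
  have "matrix_power M (Suc m) *v w = M *v (matrix_power M m *v w)"
    by (simp add: matrix_power_def matrix_vector_mul_assoc)
  then show ?case
    using assms by (simp add: Suc vector_scalar_commute vector_smult_assoc mult.commute)
qed

text \<open>An entry of \<open>N *v w\<close> is linear in \<open>N\<close>, hence continuous in
  finite dimension, so it passes through the series and leaves the scalar series of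
  \<open>exp \<mu>\<close>.\<close>

lemma matrix_exp_eigenvector:
  fixes M :: "complex ^ 'v ^ 'v::finite"
  assumes "M *v w = \<mu> *s w"
  shows "matrix_exp M *v w = exp \<mu> *s w"
proof -
  have lin: "linear (\<lambda>N :: complex ^ 'v ^ 'v. (N *v w) $ a)" for a
    by (rule linearI)
      (simp_all add: matrix_vector_mult_def sum.distrib distrib_right scaleR_sum_right)
  have "(matrix_exp M *v w) $ a = exp \<mu> * w $ a" for a
  proof -
    have "(matrix_exp M *v w) $ a = (\<Sum>m. ((matrix_power M m /\<^sub>R fact m) *v w) $ a)"
      unfolding matrix_exp_def
      using bounded_linear.suminf[OF _ summable_matrix_exp, of "\<lambda>N. (N *v w) $ a"] lin
      by (simp add: linear_conv_bounded_linear)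
    also have "\<dots> = (\<Sum>m. (\<mu> ^ m /\<^sub>R fact m) * w $ a)"
      using linear_scale[OF lin] by (simp add: matrix_power_eigenvector[OF assms])
    also have "\<dots> = exp \<mu> * w $ a"
      using suminf_mult2[OF summable_exp_generic[of \<mu>], of "w $ a"] by (simp add: exp_def)
    finally show ?thesis .
  qed
  then show ?thesis by (simp add: vec_eq_iff)
qed

section \<open>Eigenvectors of the NEPS\<close>

text \<open>Lets sums over the vertices of the NEPS be evaluated one coordinate at a time.\<close>

lemma sum_prod_vec:
  fixes h :: "'n::finite \<Rightarrow> 'v::finite \<Rightarrow> 'c::comm_semiring_1"
  shows "(\<Sum>y\<in>(UNIV :: ('v ^ 'n) set). \<Prod>i\<in>UNIV. h i (y $ i)) = (\<Prod>i\<in>UNIV. \<Sum>a\<in>UNIV. h i a)"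
proof -
  have "(\<Prod>i\<in>UNIV. \<Sum>a\<in>UNIV. h i a) = (\<Sum>g\<in>UNIV. \<Prod>i\<in>UNIV. h i (g i))"
    by (subst prod_sum_PiE) auto
  also have "\<dots> = (\<Sum>y\<in>(UNIV :: ('v ^ 'n) set). \<Prod>i\<in>UNIV. h i (y $ i))"
    by (rule sum.reindex_bij_witness[of _ vec_nth vec_lambda]) auto
  finally show ?thesis by simp
qed

text \<open>On the vertices 1, 2, 3 these are (1, -sqrt 2, 1), (1, 0, -1) and (1, sqrt 2, 1) for
  \<open>l\<close> = -1, 0, 1, left unnormalised.\<close>

definition P3_eigenvector :: "int \<Rightarrow> 3 \<Rightarrow> complex" where
  "P3_eigenvector l x =
     (if x = 2 then complex_of_real (sqrt 2) * of_int l else if x = 3 \<and> l = 0 then -1 else 1)"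

lemma P3_iff: "P3 x y \<longleftrightarrow> (x = 2) \<noteq> (y = 2)"
proof -
  have "\<forall>x y. P3 x y \<longleftrightarrow> (x = 2) \<noteq> (y = 2)"
    unfolding forall_3 P3_def doubleton_eq_iff by simp
  then show ?thesis by blast
qed

lemma of_real_sqrt_2_mult_self: "complex_of_real (sqrt 2) * complex_of_real (sqrt 2) = 2"
  by (simp flip: of_real_mult)

lemma sum_P3_eigenvector:
  assumes "l \<in> {-1, 0, 1}"
  shows "(\<Sum>y\<in>UNIV. of_bool (P3 x y) * P3_eigenvector l y)
       = complex_of_real (sqrt 2) * of_int l * P3_eigenvector l x"
proof -
  have "\<forall>x. (\<Sum>y\<in>UNIV. of_bool (P3 x y) * P3_eigenvector l y)
          = complex_of_real (sqrt 2) * of_int l * P3_eigenvector l x"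
    unfolding forall_3 sum_3 P3_iff P3_eigenvector_def
    using assms by (auto simp: of_real_sqrt_2_mult_self)
  then show ?thesis by blast
qed

text \<open>The denominators are the squared norms of the eigenvectors.\<close>

lemma P3_eigenvector_completeness:
  "(\<Sum>l\<in>{-1, 0, 1}. P3_eigenvector l v / (if l = 0 then 2 else 4) * P3_eigenvector l x) = of_bool (x = v)"
proof -
  have "\<forall>x v. (\<Sum>l\<in>{-1, 0, 1}. P3_eigenvector l v / (if l = 0 then 2 else 4) * P3_eigenvector l x)
      = of_bool (x = v)"
    unfolding forall_3 P3_eigenvector_def by (simp add: of_real_sqrt_2_mult_self)
  then show ?thesis by blast
qed

definition NEPS_eigenvector :: "('n::finite \<Rightarrow> int) \<Rightarrow> complex ^ (3 ^ 'n)" where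
  "NEPS_eigenvector g = (\<chi> x. \<Prod>i\<in>UNIV. P3_eigenvector (g i) (x $ i))"

definition NEPS_eigenvalue :: "(bit ^ 'n::finite) set \<Rightarrow> ('n \<Rightarrow> int) \<Rightarrow> complex" where
  "NEPS_eigenvalue \<Omega> g = (\<Sum>\<beta>\<in>\<Omega>. \<Prod>i | \<beta> $ i \<noteq> 0. complex_of_real (sqrt 2) * of_int (g i))"

lemma prod_of_bool_eq:
  assumes "finite A"
  shows "(\<Prod>i\<in>A. of_bool (P i)) = (of_bool (\<forall>i\<in>A. P i) :: 'c::comm_semiring_1)"
  using assms by (induction A rule: finite_induct) auto

text \<open>Since \<open>P\<^sub>3\<close> has no loops, an edge determines the \<open>\<beta>\<close> it comes from.\<close>

lemma adjacency_NEPS_P3: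
  fixes x y :: "3 ^ 'n::finite"
  shows "adjacency_matrix (NEPS (\<lambda>_. P3) \<Omega>) $ x $ y =
     (\<Sum>\<beta>\<in>\<Omega>. \<Prod>i\<in>UNIV. of_bool (if \<beta> $ i = 0 then x $ i = y $ i else P3 (x $ i) (y $ i)))"
proof -
  \<comment> \<open>The indicator of the coordinates where \<open>x\<close> and \<open>y\<close>
    differ is the only \<beta> that can join them.\<close>
  define b :: "bit ^ 'n" where "b = (\<chi> i. of_bool (x $ i \<noteq> y $ i))"
  define Q where "Q \<beta> \<longleftrightarrow> (\<forall>i. if \<beta> $ i = 0 then x $ i = y $ i else P3 (x $ i) (y $ i))" for \<beta> :: "bit ^ 'n"
  have Q_b: "\<beta> = b" if "Q \<beta>" for \<beta>
    using that by (auto simp: Q_def b_def vec_eq_iff P3_iff split: if_splits)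
  have "(\<beta> $ i = 0 \<longrightarrow> A) \<and> (\<beta> $ i = 1 \<longrightarrow> B) \<longleftrightarrow> (if \<beta> $ i = 0 then A else B)"
    for \<beta> :: "bit ^ 'n" and i A B
    by (cases "\<beta> $ i") simp_all
  then have "NEPS (\<lambda>_. P3) \<Omega> x y \<longleftrightarrow> (\<exists>\<beta>\<in>\<Omega>. Q \<beta>)"
    by (simp only: NEPS_def Q_def)
  also have "\<dots> \<longleftrightarrow> b \<in> \<Omega> \<and> Q b"
    using Q_b by blast
  finally have "adjacency_matrix (NEPS (\<lambda>_. P3) \<Omega>) $ x $ y = of_bool (b \<in> \<Omega> \<and> Q b)"
    by (simp add: adjacency_matrix_def)
  also have "\<dots> = (\<Sum>\<beta>\<in>\<Omega>. if \<beta> = b then of_bool (Q b) else 0)"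
    by (simp add: sum.delta)
  also have "\<dots> = (\<Sum>\<beta>\<in>\<Omega>. of_bool (Q \<beta>))"
    by (rule sum.cong) (use Q_b in auto)
  also have "\<dots> = (\<Sum>\<beta>\<in>\<Omega>. \<Prod>i\<in>UNIV. of_bool (if \<beta> $ i = 0 then x $ i = y $ i else P3 (x $ i) (y $ i)))"
    by (simp only: Q_def prod_of_bool_eq finite ball_UNIV)
  finally show ?thesis .
qed

text \<open>Each \<beta> contributes a tensor product of identities and copies of the adjacency
  matrix of P_3, and each tensor factor scales its own factor of the product vector.\<close>

lemma adjacency_NEPS_eigenvector:
  fixes g :: "'n::finite \<Rightarrow> int"
  assumes "\<And>i. g i \<in> {-1, 0, 1}"
  shows "adjacency_matrix (NEPS (\<lambda>_. P3) \<Omega>) *v NEPS_eigenvector g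
       = NEPS_eigenvalue \<Omega> g *s NEPS_eigenvector g"
proof -
  have "(adjacency_matrix (NEPS (\<lambda>_. P3) \<Omega>) *v NEPS_eigenvector g) $ x
      = NEPS_eigenvalue \<Omega> g * NEPS_eigenvector g $ x" for x
  proof -
    define h where
      "h \<beta> i a = of_bool (if \<beta> $ i = 0 then x $ i = a else P3 (x $ i) a) * P3_eigenvector (g i) a"
      for \<beta> :: "bit ^ 'n" and i a
    have "(adjacency_matrix (NEPS (\<lambda>_. P3) \<Omega>) *v NEPS_eigenvector g) $ x
        = (\<Sum>y\<in>UNIV. \<Sum>\<beta>\<in>\<Omega>. \<Prod>i\<in>UNIV. h \<beta> i (y $ i))"
      by (simp add: matrix_vector_mult_def adjacency_NEPS_P3 NEPS_eigenvector_def
          sum_distrib_right prod.distrib h_def)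
    also have "\<dots> = (\<Sum>\<beta>\<in>\<Omega>. \<Prod>i\<in>UNIV. \<Sum>a\<in>UNIV. h \<beta> i a)"
      by (subst sum.swap) (simp only: sum_prod_vec)
    also have "\<dots> = (\<Sum>\<beta>\<in>\<Omega>. \<Prod>i\<in>UNIV. (if \<beta> $ i \<noteq> 0 then complex_of_real (sqrt 2) * of_int (g i) else 1) * P3_eigenvector (g i) (x $ i))"
    proof (intro sum.cong prod.cong refl)
      fix \<beta> :: "bit ^ 'n" and i
      show "(\<Sum>a\<in>UNIV. h \<beta> i a)
          = (if \<beta> $ i \<noteq> 0 then complex_of_real (sqrt 2) * of_int (g i) else 1) * P3_eigenvector (g i) (x $ i)"
      proof (cases "\<beta> $ i = 0")
        case True
        then have "(\<Sum>a\<in>UNIV. h \<beta> i a) = (\<Sum>a\<in>UNIV. if x $ i = a then P3_eigenvector (g i) a else 0)"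
          by (intro sum.cong) (auto simp: h_def)
        then show ?thesis using True by simp
      next
        case False
        then show ?thesis using sum_P3_eigenvector[OF assms, of "x $ i" i] by (simp add: h_def)
      qed
    qed
    also have "\<dots> = NEPS_eigenvalue \<Omega> g * NEPS_eigenvector g $ x"
      by (simp add: NEPS_eigenvalue_def NEPS_eigenvector_def prod.distrib sum_distrib_right
          flip: prod.inter_filter)
    finally show ?thesis .
  qed
  then show ?thesis by (simp add: vec_eq_iff)
qed

text \<open>A standard basis vector is a product of those of the coordinates; each is expanded by
  completeness in P_3 and the product is multiplied out.\<close>

lemma NEPS_eigenvector_expansion:
  fixes v :: "3 ^ 'n::finite"
  shows "axis v 1 = (\<Sum>g\<in>PiE UNIV (\<lambda>_. {-1, 0, 1}).
      (\<Prod>i\<in>UNIV. P3_eigenvector (g i) (v $ i) / (if g i = 0 then 2 else 4)) *s NEPS_eigenvector g)"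
proof -
  have "axis v 1 $ x = (\<Prod>i\<in>UNIV. of_bool (x $ i = v $ i) :: complex)" for x :: "3 ^ 'n"
    by (auto simp: axis_def vec_eq_iff prod_of_bool_eq)
  then show ?thesis
    unfolding P3_eigenvector_completeness[symmetric]
    by (subst (asm) prod_sum_PiE) (simp_all add: vec_eq_iff NEPS_eigenvector_def flip: prod.distrib)
qed

section \<open>Phases at the transfer time\<close>

text \<open>The map 0 to 1, 1 to -1 is a homomorphism from addition in \<open>bit\<close> to
  multiplication of signs.\<close>

lemma prod_sign_bit:
  fixes f :: "'a \<Rightarrow> bit"
  assumes "finite S"
  shows "(\<Prod>x\<in>S. if f x \<noteq> 0 then -1 else 1 :: complex) = (if (\<Sum>x\<in>S. f x) = 0 then 1 else -1)"
  using assms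
proof (induction S)
  case (insert x S)
  then show ?case by (cases "f x"; cases "sum f S") simp_all
qed simp

text \<open>With \<open>weight \<beta> = k + 2 * d\<close>, the powers of \<open>sqrt 2\<close>
  reduce to \<open>2 ^ d\<close>, so the phase is a rotation by \<open>pi * 2 ^ d * p\<close> up to
  orientation, where \<open>p\<close> is the product of the labels. It is a whole number of turns if
  \<open>d > 0\<close> or \<open>p = 0\<close>; for \<open>d = 0\<close> both \<open>p = 1\<close>
  and \<open>p = -1\<close> give -1.\<close>

lemma NEPS_phase_term:
  fixes \<beta> :: "bit ^ 'n::finite"
  assumes g: "\<And>i. g i \<in> {-1, 0, 1 :: int}"
    and k: "k \<le> weight \<beta>" "even (weight \<beta>) = even k"
  shows "exp (- \<i> * complex_of_real (pi / sqrt 2 ^ k) * (\<Prod>i | \<beta> $ i \<noteq> 0. complex_of_real (sqrt 2) * of_int (g i)))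
       = (if weight \<beta> = k \<and> (\<forall>i. \<beta> $ i \<noteq> 0 \<longrightarrow> g i \<noteq> 0) then -1 else 1)"
proof -
  define p where "p = (\<Prod>i | \<beta> $ i \<noteq> 0. g i)"
  have p0: "p = 0 \<longleftrightarrow> \<not> (\<forall>i. \<beta> $ i \<noteq> 0 \<longrightarrow> g i \<noteq> 0)"
    by (auto simp: p_def prod_zero_iff)
  have abs_g: "\<bar>g i\<bar> = 1" if "g i \<noteq> 0" for i
    using that g[of i] by auto
  have p1: "\<bar>p\<bar> = 1" if "p \<noteq> 0"
  proof -
    have "\<forall>i. \<beta> $ i \<noteq> 0 \<longrightarrow> g i \<noteq> 0"
      using that p0 by blast
    then show ?thesis
      unfolding p_def abs_prod by (intro prod.neutral) (use abs_g in blast)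
  qed
  obtain d where d: "weight \<beta> = k + 2 * d"
    using k by (metis even_add evenE le_add_diff_inverse)
  have "(\<Prod>i | \<beta> $ i \<noteq> 0. complex_of_real (sqrt 2) * of_int (g i)) = complex_of_real (sqrt 2 ^ weight \<beta> * of_int p)"
    by (simp add: prod.distrib weight_def p_def)
  also have "sqrt 2 ^ weight \<beta> = sqrt 2 ^ k * 2 ^ d"
    by (simp add: d power_add power_mult)
  finally have *: "- \<i> * complex_of_real (pi / sqrt 2 ^ k) * (\<Prod>i | \<beta> $ i \<noteq> 0. complex_of_real (sqrt 2) * of_int (g i))
      = \<i> * complex_of_real (pi * of_int (- (2 ^ d * p)))"
    by (simp add: field_simps)
  have exp_eq: "exp (- \<i> * complex_of_real (pi / sqrt 2 ^ k) * (\<Prod>i | \<beta> $ i \<noteq> 0. complex_of_real (sqrt 2) * of_int (g i)))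
      = cis (pi * of_int (- (2 ^ d * p)))"
    unfolding * cis_conv_exp by simp
  show ?thesis
    unfolding exp_eq
  proof (cases "d = 0")
    case True
    have "p = 0 \<or> p = 1 \<or> p = -1"
      using p1 by linarith
    then show "cis (pi * of_int (- (2 ^ d * p)))
        = (if weight \<beta> = k \<and> (\<forall>i. \<beta> $ i \<noteq> 0 \<longrightarrow> g i \<noteq> 0) then -1 else 1)"
      using p0 d True by (auto simp: complex_eq_iff)
  next
    case False
    then obtain d' where "d = Suc d'" by (cases d) auto
    then have "pi * of_int (- (2 ^ d * p)) = 2 * pi * of_int (- (2 ^ d' * p))"
      by simp
    then have "cis (pi * of_int (- (2 ^ d * p))) = 1"
      by (metis cis_multiple_2pi Ints_of_int)
    then show "cis (pi * of_int (- (2 ^ d * p)))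
        = (if weight \<beta> = k \<and> (\<forall>i. \<beta> $ i \<noteq> 0 \<longrightarrow> g i \<noteq> 0) then -1 else 1)"
      using False d by simp
  qed
qed

text \<open>Only \<open>g j\<close> may vanish. If it does, the \<beta> of weight \<open>k\<close>
  with \<open>\<beta> $ j = 1\<close> lose their sign -1, and by \<open>j\<close> their number is
  odd.\<close>

lemma NEPS_phase:
  fixes \<Omega> :: "(bit ^ 'n::finite) set"
  assumes g: "\<And>i. g i \<in> {-1, 0, 1}" and g_nz: "\<And>i. i \<noteq> j \<Longrightarrow> g i \<noteq> 0"
    and k: "\<And>\<beta>. \<beta> \<in> \<Omega> \<Longrightarrow> k \<le> weight \<beta> \<and> even (weight \<beta>) = even k"
    and j: "(\<Sum>\<beta> | \<beta> \<in> \<Omega> \<and> weight \<beta> = k. \<beta> $ j) \<noteq> 0"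
  shows "exp (- \<i> * complex_of_real (pi / sqrt 2 ^ k) * NEPS_eigenvalue \<Omega> g)
       = (-1) ^ card {\<beta> \<in> \<Omega>. weight \<beta> = k} * (if g j = 0 then -1 else 1)"
proof -
  let ?S = "{\<beta> \<in> \<Omega>. weight \<beta> = k}"
  have "exp (- \<i> * complex_of_real (pi / sqrt 2 ^ k) * NEPS_eigenvalue \<Omega> g)
      = (\<Prod>\<beta>\<in>\<Omega>. if weight \<beta> = k \<and> (\<forall>i. \<beta> $ i \<noteq> 0 \<longrightarrow> g i \<noteq> 0) then -1 else 1)"
    unfolding NEPS_eigenvalue_def sum_distrib_left
    by (subst exp_sum) (auto intro!: prod.cong simp only: NEPS_phase_term[OF g] k finite)
  also have "\<dots> = (\<Prod>\<beta>\<in>?S. if \<forall>i. \<beta> $ i \<noteq> 0 \<longrightarrow> g i \<noteq> 0 then -1 else 1)"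
    by (subst prod.inter_filter) (auto intro!: prod.cong)
  \<comment> \<open>The second factor undoes the -1 exactly when \<beta> meets the vanishing label
    at \<open>j\<close>.\<close>
  also have "\<dots> = (\<Prod>\<beta>\<in>?S. (-1) * (if g j = 0 then if \<beta> $ j \<noteq> 0 then -1 else 1 else 1))"
    by (rule prod.cong) (use g_nz in \<open>force+\<close>)
  also have "\<dots> = (-1) ^ card ?S * (\<Prod>\<beta>\<in>?S. if g j = 0 then if \<beta> $ j \<noteq> 0 then -1 else 1 else 1)"
    by (subst prod.distrib) simp
  also have "(\<Prod>\<beta>\<in>?S. if g j = 0 then if \<beta> $ j \<noteq> 0 then -1 else 1 else 1) = (if g j = 0 then -1 else 1 :: complex)"
    using j prod_sign_bit[of ?S "\<lambda>\<beta>. \<beta> $ j"] by (cases "g j = 0") simp_all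
  finally show ?thesis .
qed

section \<open>Transfer between two vertices that differ in a single coordinate\<close>

theorem theorem4p12:
  fixes \<Omega> \<Omega>' :: "(bit ^ 'n::finite) set" and k :: nat
  assumes "0 \<notin> \<Omega>"
    and "rank_Z2 \<Omega> = CARD('n)"
    and "(\<forall>\<beta>\<in>\<Omega>. even (weight \<beta>)) \<or> (\<forall>\<beta>\<in>\<Omega>. odd (weight \<beta>))"
    and "k = Min (weight ` \<Omega>)"
    and "\<Omega>' = {\<beta>\<in>\<Omega>. weight \<beta> = k}"
    and "(\<Sum>\<beta>\<in>\<Omega>'. \<beta>) \<noteq> 0"
  shows "\<exists>u v. u \<noteq> v \<and> perfect_state_transfer (NEPS (\<lambda>_. P3) \<Omega>) u v (pi / sqrt 2 ^ k)"
proof -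
  obtain j where j: "(\<Sum>\<beta>\<in>\<Omega>'. \<beta> $ j) \<noteq> 0"
    using assms(6) by (auto simp: vec_eq_iff sum_component)
  \<comment> \<open>Nonemptiness makes the minimum attained, so that \<open>k\<close> has the common
    parity of the weights.\<close>
  have "\<Omega> \<noteq> {}"
    using j assms(5) by auto
  then have "k \<in> weight ` \<Omega>"
    unfolding assms(4) by (intro Min_in) auto
  then have k: "k \<le> weight \<beta> \<and> even (weight \<beta>) = even k" if "\<beta> \<in> \<Omega>" for \<beta>
    using that assms(3,4) by auto
  define u v :: "3 ^ 'n" where "u = (\<chi> i. if i = j then 1 else 2)" and "v = (\<chi> i. if i = j then 3 else 2)"
  define M where "M = (\<chi> a b. - \<i> * complex_of_real (pi / sqrt 2 ^ k) * adjacency_matrix (NEPS (\<lambda>_. P3) \<Omega>) $ a $ b)"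
  define G where "G = PiE (UNIV :: 'n set) (\<lambda>_. {-1, 0, 1 :: int})"
  \<comment> \<open>The coefficients of \<open>axis w 1\<close> in the eigenvector expansion, needed
    for both endpoints.\<close>
  define c where "c w g = (\<Prod>i\<in>UNIV. P3_eigenvector (g i) (w $ i) / (if g i = 0 then 2 else 4))"
    for w :: "3 ^ 'n" and g
  define \<epsilon> :: complex where "\<epsilon> = (-1) ^ card \<Omega>'"
  define \<theta> where "\<theta> g = - \<i> * complex_of_real (pi / sqrt 2 ^ k) * NEPS_eigenvalue \<Omega> g" for g
  have G: "g i \<in> {-1, 0, 1}" if "g \<in> G" for g i
    using that by (auto simp: G_def PiE_def)
  have expM: "matrix_exp M *v NEPS_eigenvector g = exp (\<theta> g) *s NEPS_eigenvector g" if "g \<in> G" for g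
  proof (rule matrix_exp_eigenvector)
    have "M *v w = (- \<i> * complex_of_real (pi / sqrt 2 ^ k)) *s (adjacency_matrix (NEPS (\<lambda>_. P3) \<Omega>) *v w)" for w
      by (simp add: M_def matrix_vector_mult_def vec_eq_iff sum_distrib_left sum_negf mult.assoc)
    then show "M *v NEPS_eigenvector g = \<theta> g *s NEPS_eigenvector g"
      by (simp only: adjacency_NEPS_eigenvector[of g, OF G[OF that]] \<theta>_def vector_smult_assoc)
  qed
  \<comment> \<open>The exponential therefore carries the expansion of \<open>axis v 1\<close> to
    \<epsilon> times that of \<open>axis u 1\<close>, coefficient by coefficient.\<close>
  have phase: "c v g * exp (\<theta> g) = \<epsilon> * c u g" if "g \<in> G" for g
  proof (cases "\<exists>i. i \<noteq> j \<and> g i = 0")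
    case True
    \<comment> \<open>The eigenvector with label 0 vanishes at vertex 2, the entry of both endpoints
      at \<open>i\<close>.\<close>
    then have "c v g = 0" "c u g = 0"
      by (auto simp: c_def u_def v_def P3_eigenvector_def prod_zero_iff)
    then show ?thesis by simp
  next
    case False
    then have "exp (\<theta> g) = \<epsilon> * (if g j = 0 then -1 else 1)"
      unfolding \<theta>_def \<epsilon>_def assms(5)
      using j[unfolded assms(5)] by (intro NEPS_phase[OF G[OF that] _ k]) auto
    \<comment> \<open>Swapping the end vertices 1 and 3 negates the eigenvector with label 0 and
      fixes the other two.\<close>
    moreover have "c u g = (if g j = 0 then -1 else 1) * c v g"
      by (auto simp: c_def prod.remove[of UNIV j] u_def v_def P3_eigenvector_def)
    ultimately show ?thesis by simp
  qed
  have "matrix_exp M *v axis v 1 = (\<Sum>g\<in>G. c v g *s (matrix_exp M *v NEPS_eigenvector g))"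
    unfolding NEPS_eigenvector_expansion c_def G_def
    by (simp add: vec.linear_sum[OF matrix_vector_mul_linear_gen] vector_scalar_commute)
  also have "\<dots> = (\<Sum>g\<in>G. (\<epsilon> * c u g) *s NEPS_eigenvector g)"
    by (intro sum.cong refl) (simp add: expM vector_smult_assoc phase)
  also have "\<dots> = \<epsilon> *s axis u 1"
    unfolding NEPS_eigenvector_expansion c_def G_def
    by (simp add: vec.scale_sum_right vector_smult_assoc)
  finally have "(matrix_exp M *v axis v 1) $ u = \<epsilon>"
    by (simp add: axis_def)
  moreover have "(matrix_exp M *v axis v 1) $ u = matrix_exp M $ u $ v"
    by (simp add: matrix_vector_mult_def axis_def if_distrib cong: if_cong)
  ultimately have "matrix_exp M $ u $ v = \<epsilon>"
    by simp
  then have "perfect_state_transfer (NEPS (\<lambda>_. P3) \<Omega>) u v (pi / sqrt 2 ^ k)"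
    unfolding perfect_state_transfer_def M_def[symmetric] by (simp add: \<epsilon>_def norm_power)
  moreover have "u $ j \<noteq> v $ j"
    by (simp add: u_def v_def)
  ultimately show ?thesis by metis
qed

end
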